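(* Let $\lambda_1,\lambda_2$ be nonempty sets of integers bigger than $1$. If $\lambda_1\ne\lambda_2$, then the $\lambda_1$-archipelago is not coarsely equivalent to the $\lambda_2$-archipelago (for any choice of the lists of islands used to build them).
   Context: Archipelagos. Given a nonempty set $\lambda$ of integers bigger than $1$, choose a list $X_i$, $i\ge1$, of finite metric spaces (islands) such that: (1) the cardinality $n_i$ of $X_i$ belongs to $\lambda$; (2) there is an integer $m_i\ge n_i$ such that $d(x,y)=m_i$ for all $x\neq y$ in $X_i$ (so $m_i=\mathrm{diam}(X_i)$); (3) for each $n\in\lambda$ and each integer $m\ge n$, the set of indices $i$ with $\mathrm{diam}(X_i)=m$ and $|X_i|=n$ is infinite. Put $k_i=\sum_{j\le i}m_j$. For a bounded ultrametric space $X$ of diameter at most $M$, $\mathrm{Cone}(X,M)$ is the pointed ultrametric space obtained from $X$ by adding one point $v$ (the base point) with $d(v,x)=M$ for all $x\in X$. The metric wedge of a family of pointed metric spaces is obtained by identifying all base points to one point; its metric restricts to the given metric on each member of the family, and for non-base points $z,z'$ lying in different members, $d(z,z')$ is the maximum of the distances from $z$ and $z'$ to their base points. The $\lambda$-archipelago is the metric wedge of all the spaces $\mathrm{Cone}(X_i,k_i)$, $i\ge1$. Coarse equivalence. A map $f\colon X\to Y$ of metric spaces is coarse if it is metrically proper (preimages of bounded sets are bounded) and large scale uniform: there is a nondecreasing function $\delta_f\colon[0,\infty)\to[0,\infty)$ with $d_Y(f(x),f(x'))\le\delta_f(d_X(x,x'))$ for all $x,x'$. $X$ and $Y$ are coarsely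 equivalent if there are a constant $C>0$ and coarse maps $f\colon X\to Y$, $g\colon Y\to X$ with $d(g(f(x)),x)\le C$ for all $x\in X$ and $d(f(g(y)),y)\le C$ for all $y\in Y$. *)

theory Defs
  imports "HOL-Analysis.Analysis"
begin

text \<open>
  Metric spaces are given as in the locale \<^locale>\<open>Metric_space\<close>: a carrier set together with a
  distance function.
\<close>

definition diam :: "'a set \<Rightarrow> ('a \<Rightarrow> 'a \<Rightarrow> real) \<Rightarrow> real"
  where "diam X d = Sup {d x y | x y. x \<in> X \<and> y \<in> X}"

text \<open>In a cone, \<^const>\<open>None\<close> is the added base point.\<close>

definition cone_set :: "'a set \<Rightarrow> 'a option set"
  where "cone_set X = insert None (Some ` X)"

fun cone_dist :: "('a \<Rightarrow> 'a \<Rightarrow> real) \<Rightarrow> real \<Rightarrow> 'a option \<Rightarrow> 'a option \<Rightarrow> real"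
  where
    "cone_dist d M None None = 0"
  | "cone_dist d M None (Some x) = M"
  | "cone_dist d M (Some x) None = M"
  | "cone_dist d M (Some x) (Some y) = d x y"

text \<open>
  Metric wedge of the spaces with carriers \<open>C i\<close>, distances \<open>d i\<close> and base points \<open>b i\<close>: the common
  base point is \<^const>\<open>None\<close>, and \<open>Some (i, x)\<close> is the non-base point \<open>x\<close> of the \<open>i\<close>-th space.
\<close>

definition wedge_set :: "('i \<Rightarrow> 'a set) \<Rightarrow> ('i \<Rightarrow> 'a) \<Rightarrow> ('i \<times> 'a) option set"
  where "wedge_set C b = insert None {Some (i, x) | i x. x \<in> C i \<and> x \<noteq> b i}"

fun wedge_dist ::
    "('i \<Rightarrow> 'a \<Rightarrow> 'a \<Rightarrow> real) \<Rightarrow> ('i \<Rightarrow> 'a) \<Rightarrow> ('i \<times> 'a) option \<Rightarrow> ('i \<times> 'a) option \<Rightarrow> real"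
  where
    "wedge_dist d b None None = 0"
  | "wedge_dist d b None (Some (i, x)) = d i (b i) x"
  | "wedge_dist d b (Some (i, x)) None = d i x (b i)"
  | "wedge_dist d b (Some (i, x)) (Some (j, y)) =
       (if i = j then d i x y else max (d i x (b i)) (d j y (b j)))"

text \<open>
  Islands are indexed from \<open>0\<close>: \<open>X i\<close> is the \<open>(i + 1)\<close>-st island of the list.
\<close>

definition islands :: "nat set \<Rightarrow> (nat \<Rightarrow> 'a set) \<Rightarrow> (nat \<Rightarrow> 'a \<Rightarrow> 'a \<Rightarrow> real) \<Rightarrow> bool"
  where "islands L X d \<longleftrightarrow>
    (\<forall>i. Metric_space (X i) (d i) \<and> finite (X i)) \<and>
    (\<forall>i. card (X i) \<in> L) \<and>
    (\<forall>i. \<exists>m::nat. m \<ge> card (X i) \<and> (\<forall>x\<in>X i. \<forall>y\<in>X i. x \<noteq> y \<longrightarrow> d i x y = real m)) \<and>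
    (\<forall>n\<in>L. \<forall>m::nat. m \<ge> n \<longrightarrow> infinite {i. diam (X i) (d i) = real m \<and> card (X i) = n})"

text \<open>
  Since every island has at least two points, its diameter is its unique nonzero distance.
\<close>

definition cone_height :: "(nat \<Rightarrow> 'a set) \<Rightarrow> (nat \<Rightarrow> 'a \<Rightarrow> 'a \<Rightarrow> real) \<Rightarrow> nat \<Rightarrow> real"
  where "cone_height X d i = (\<Sum>j\<le>i. diam (X j) (d j))"

definition archipelago_set :: "(nat \<Rightarrow> 'a set) \<Rightarrow> (nat \<times> 'a option) option set"
  where "archipelago_set X = wedge_set (\<lambda>i. cone_set (X i)) (\<lambda>i. None)"

definition archipelago_dist ::
    "(nat \<Rightarrow> 'a set) \<Rightarrow> (nat \<Rightarrow> 'a \<Rightarrow> 'a \<Rightarrow> real) \<Rightarrow>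
     (nat \<times> 'a option) option \<Rightarrow> (nat \<times> 'a option) option \<Rightarrow> real"
  where "archipelago_dist X d = wedge_dist (\<lambda>i. cone_dist (d i) (cone_height X d i)) (\<lambda>i. None)"

definition metrically_proper ::
    "'a set \<Rightarrow> ('a \<Rightarrow> 'a \<Rightarrow> real) \<Rightarrow> 'b set \<Rightarrow> ('b \<Rightarrow> 'b \<Rightarrow> real) \<Rightarrow> ('a \<Rightarrow> 'b) \<Rightarrow> bool"
  where "metrically_proper X dX Y dY f \<longleftrightarrow>
    (\<forall>B. Metric_space.mbounded Y dY B \<longrightarrow> Metric_space.mbounded X dX {x \<in> X. f x \<in> B})"

definition large_scale_uniform ::
    "'a set \<Rightarrow> ('a \<Rightarrow> 'a \<Rightarrow> real) \<Rightarrow> ('b \<Rightarrow> 'b \<Rightarrow> real) \<Rightarrow> ('a \<Rightarrow> 'b) \<Rightarrow> bool"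
  where "large_scale_uniform X dX dY f \<longleftrightarrow>
    (\<exists>\<delta>::real \<Rightarrow> real. \<delta> \<in> {0..} \<rightarrow> {0..} \<and> mono_on {0..} \<delta> \<and>
       (\<forall>x\<in>X. \<forall>x'\<in>X. dY (f x) (f x') \<le> \<delta> (dX x x')))"

definition coarse_map ::
    "'a set \<Rightarrow> ('a \<Rightarrow> 'a \<Rightarrow> real) \<Rightarrow> 'b set \<Rightarrow> ('b \<Rightarrow> 'b \<Rightarrow> real) \<Rightarrow> ('a \<Rightarrow> 'b) \<Rightarrow> bool"
  where "coarse_map X dX Y dY f \<longleftrightarrow>
    f \<in> X \<rightarrow> Y \<and> metrically_proper X dX Y dY f \<and> large_scale_uniform X dX dY f"

definition coarsely_equivalent ::
    "'a set \<Rightarrow> ('a \<Rightarrow> 'a \<Rightarrow> real) \<Rightarrow> 'b set \<Rightarrow> ('b \<Rightarrow> 'b \<Rightarrow> real) \<Rightarrow> bool"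
  where "coarsely_equivalent X dX Y dY \<longleftrightarrow>
    (\<exists>C>0. \<exists>f g. coarse_map X dX Y dY f \<and> coarse_map Y dY X dX g \<and>
       (\<forall>x\<in>X. dX (g (f x)) x \<le> C) \<and> (\<forall>y\<in>Y. dY (f (g y)) y \<le> C))"

lemma Metric_space_cone:
  assumes "Metric_space X d" and "M > 0" and "\<And>x y. x \<in> X \<Longrightarrow> y \<in> X \<Longrightarrow> d x y \<le> M"
  shows "Metric_space (cone_set X) (cone_dist d M)"
proof -
  interpret Metric_space X d by fact
  show ?thesis
  proof
    fix x y
    show "0 \<le> cone_dist d M x y" using assms(2) by (cases x; cases y) auto
    show "cone_dist d M x y = cone_dist d M y x" by (cases x; cases y) (auto simp: commute)
    show "cone_dist d M x y = 0 \<longleftrightarrow> x = y" if "x \<in> cone_set X" "y \<in> cone_set X"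
      using that assms(2) by (auto simp: cone_set_def)
  next
    have diam2: "d x y \<le> 2 * M" if "x \<in> X" "y \<in> X" for x y
      using assms(3)[OF that] assms(2) by linarith
    fix x y z assume "x \<in> cone_set X" "y \<in> cone_set X" "z \<in> cone_set X"
    then show "cone_dist d M x z \<le> cone_dist d M x y + cone_dist d M y z"
      using assms(2) triangle diam2 by (auto simp: cone_set_def)
  qed
qed

lemma Metric_space_wedge:
  assumes ms: "\<And>i. Metric_space (C i) (d i)" and b: "\<And>i. b i \<in> C i"
  shows "Metric_space (wedge_set C b) (wedge_dist d b)"
proof
  note nonneg = Metric_space.nonneg[OF ms] and comm = Metric_space.commute[OF ms]
    and zero = Metric_space.zero[OF ms] and tri = Metric_space.triangle[OF ms]
  fix x y
  show "0 \<le> wedge_dist d b x y"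
    using nonneg by (cases "(d, b, x, y)" rule: wedge_dist.cases) (auto simp: le_max_iff_disj)
  show "wedge_dist d b x y = wedge_dist d b y x"
    using comm by (cases "(d, b, x, y)" rule: wedge_dist.cases) (auto simp: max.commute)
  show "wedge_dist d b x y = 0 \<longleftrightarrow> x = y" if xy: "x \<in> wedge_set C b" "y \<in> wedge_set C b"
  proof -
    have pos: "d i u (b i) > 0" if "u \<in> C i" "u \<noteq> b i" for i u
      using zero[of u i "b i"] nonneg[of i u "b i"] that b[of i] by linarith
    show ?thesis
    proof (cases "\<exists>i u j v. x = Some (i, u) \<and> y = Some (j, v)")
      case True
      then obtain i u j v where *: "x = Some (i, u)" "y = Some (j, v)" by blast
      then have uv: "u \<in> C i" "u \<noteq> b i" "v \<in> C j" "v \<noteq> b j"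
        using xy by (auto simp: wedge_set_def)
      then show ?thesis
        using * pos[of u i] zero[of u i v] by auto
    next
      case False
      then show ?thesis
        using xy pos comm[of _ "b _"] by (fastforce simp: wedge_set_def)
    qed
  qed
next
  note nonneg = Metric_space.nonneg[OF ms] and comm = Metric_space.commute[OF ms]
    and tri = Metric_space.triangle[OF ms]
  define p where "p x = (case x of None \<Rightarrow> 0 | Some (i, u) \<Rightarrow> d i u (b i))" for x
  define s where "s x y \<longleftrightarrow> (\<exists>i u v. x = Some (i, u) \<and> y = Some (i, v))" for x y :: "('a \<times> 'b) option"
  have W: "wedge_dist d b x y = (if s x y then wedge_dist d b x y else max (p x) (p y))" for x y
    using comm nonneg by (cases "(d, b, x, y)" rule: wedge_dist.cases) (auto simp: p_def s_def max_def intro: antisym)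
  have p0: "p x \<ge> 0" for x
    using nonneg by (auto simp: p_def split: option.splits)
  fix x y z assume xyz: "x \<in> wedge_set C b" "y \<in> wedge_set C b" "z \<in> wedge_set C b"
  have T: "p x \<le> wedge_dist d b x y + p y" "p y \<le> wedge_dist d b x y + p x"
      "wedge_dist d b x y \<le> p x + p y"
    if "s x y" "x \<in> wedge_set C b" "y \<in> wedge_set C b" for x y
  proof -
    obtain i u v where *: "x = Some (i, u)" "y = Some (i, v)" using \<open>s x y\<close> by (auto simp: s_def)
    then have uv: "u \<in> C i" "v \<in> C i" using that by (auto simp: wedge_set_def)
    show "p x \<le> wedge_dist d b x y + p y" "p y \<le> wedge_dist d b x y + p x"
      "wedge_dist d b x y \<le> p x + p y"
      using * tri[OF uv(1) uv(2) b] tri[OF uv(2) uv(1) b] tri[OF uv(1) b uv(2)]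
        comm[of i u v] comm[of i v "b i"] by (auto simp: p_def)
  qed
  show "wedge_dist d b x z \<le> wedge_dist d b x y + wedge_dist d b y z"
  proof (cases "s x y \<and> s y z")
    case True
    then show ?thesis using xyz tri by (auto simp: s_def wedge_set_def)
  next
    case False
    consider "s x y" "\<not> s y z" "\<not> s x z" | "\<not> s x y" "s y z" "\<not> s x z"
      | "\<not> s x y" "\<not> s y z" "s x z" | "\<not> s x y" "\<not> s y z" "\<not> s x z"
      using False by (auto simp: s_def)
    then show ?thesis
    proof cases
      case 1
      then show ?thesis using T[of x y] W[of x z] W[of y z] xyz p0[of x] p0[of y] p0[of z]
        by (auto simp: max_def split: if_splits)
    next
      case 2
      then show ?thesis using T[of y z] W[of x z] W[of x y] xyz p0[of x] p0[of y] p0[of z]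
        by (auto simp: max_def split: if_splits)
    next
      case 3
      then show ?thesis using T[of x z] W[of y z] W[of x y] xyz p0[of x] p0[of y] p0[of z]
        by (auto simp: max_def split: if_splits)
    next
      case 4
      then show ?thesis using W[of x z] W[of y z] W[of x y] p0[of x] p0[of y] p0[of z]
        by (auto simp: max_def split: if_splits)
    qed
  qed
qed

lemma diam_equidistant:
  assumes "Metric_space X d" "card X > 1" "\<And>x y. x \<in> X \<Longrightarrow> y \<in> X \<Longrightarrow> x \<noteq> y \<Longrightarrow> d x y = m"
  shows "diam X d = m"
proof -
  interpret Metric_space X d by fact
  have "\<exists>x\<in>X. \<exists>y\<in>X. x \<noteq> y"
    using assms(2) card_le_Suc0_iff_eq[of X] card_gt_0_iff[of X] by fastforce
  then obtain x y where xy: "x \<in> X" "y \<in> X" "x \<noteq> y" by blast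
  have "{d x y | x y. x \<in> X \<and> y \<in> X} = {0, m}"
  proof (rule set_eqI, rule iffI)
    fix r assume "r \<in> {d x y | x y. x \<in> X \<and> y \<in> X}"
    then obtain u v where "r = d u v" "u \<in> X" "v \<in> X" by blast
    then show "r \<in> {0, m}" using assms(3)[of u v] by (cases "u = v") auto
  next
    fix r assume "r \<in> {0, m}"
    then have "r = d x x \<or> r = d x y" using xy assms(3) by auto
    then show "r \<in> {d x y | x y. x \<in> X \<and> y \<in> X}" using xy by blast
  qed
  moreover have "0 \<le> m" using assms(3)[OF xy] nonneg[of x y] by simp
  ultimately show ?thesis by (simp add: diam_def cSup_eq_Max max_def)
qed

lemma Metric_space_archipelago:
  assumes "\<forall>n\<in>L. n > 1" and "islands L X d"
  shows "Metric_space (archipelago_set X) (archipelago_dist X d)"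
proof -
  have card: "card (X i) > 1" for i
    using assms by (auto simp: islands_def)
  have dm: "diam (X i) (d i) > 0 \<and> (\<forall>x\<in>X i. \<forall>y\<in>X i. d i x y \<le> diam (X i) (d i))" for i
  proof -
    have ms: "Metric_space (X i) (d i)" using assms(2) by (simp add: islands_def)
    obtain m :: nat where m: "m \<ge> card (X i)"
        "\<And>x y. x \<in> X i \<Longrightarrow> y \<in> X i \<Longrightarrow> x \<noteq> y \<Longrightarrow> d i x y = real m"
      using assms(2) unfolding islands_def by metis
    have "diam (X i) (d i) = real m"
      using diam_equidistant[OF ms card m(2)] .
    moreover have "d i x y \<le> real m" if "x \<in> X i" "y \<in> X i" for x y
      using m(2)[of x y] that Metric_space.mdist_zero[OF ms, of x] by (cases "x = y") auto
    ultimately show ?thesis using m(1) card[of i] by auto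
  qed
  have h: "cone_height X d i \<ge> diam (X i) (d i)" for i
    unfolding cone_height_def
    by (rule member_le_sum[of i "{..i}" "\<lambda>j. diam (X j) (d j)"]) (use dm in \<open>auto intro: less_imp_le\<close>)
  show ?thesis
    unfolding archipelago_set_def archipelago_dist_def
  proof (rule Metric_space_wedge)
    fix i
    show "Metric_space (cone_set (X i)) (cone_dist (d i) (cone_height X d i))"
    proof (rule Metric_space_cone)
      show "Metric_space (X i) (d i)" using assms(2) by (simp add: islands_def)
      show "0 < cone_height X d i" using dm[of i] h[of i] by linarith
      show "d i x y \<le> cone_height X d i" if "x \<in> X i" "y \<in> X i" for x y
        using dm[of i] h[of i] that by (meson order_trans)
    qed
    show "None \<in> cone_set (X i)" by (simp add: cone_set_def)
  qed
qed

end

theory Submission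
  imports Defs
begin

text \<open>
  A subset of diameter less than \<open>r\<close> that meets the complement of the \<open>r\<close>-ball around the base point
  lies in a single island. Take an island of size \<open>n \<in> L\<^sub>1\<close> and diameter \<open>m\<close> far away from the base
  point. A coarse equivalence \<open>f\<close> maps it into one island of the second archipelago, and a coarse
  inverse \<open>g\<close> maps that island back. If \<open>m\<close> is large compared with the constant \<open>C\<close> and with the
  modulus of \<open>g\<close> at \<open>C\<close>, both islands have all nonzero distances greater than \<open>C\<close>, so \<open>f\<close> and \<open>g\<close>
  are mutually inverse bijections between them and \<open>n \<in> L\<^sub>2\<close>.
\<close>

locale archipelago =
  fixes L :: "nat set" and X :: "nat \<Rightarrow> 'a set" and d :: "nat \<Rightarrow> 'a \<Rightarrow> 'a \<Rightarrow> real"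
  assumes sizes: "\<forall>n\<in>L. n > 1"
    and islands: "islands L X d"
begin

abbreviation "A \<equiv> archipelago_set X"
abbreviation "D \<equiv> archipelago_dist X d"

text \<open>The outer \<open>Some\<close> marks a non-base point of the wedge, the inner
  \<open>Some\<close> a point of the cone other than its apex. The islands thus partition
  \<open>A\<close> minus \<open>None\<close>.\<close>

definition island :: "nat \<Rightarrow> (nat \<times> 'a option) option set"
  where "island i = (\<lambda>x. Some (i, Some x)) ` X i"

sublocale Metric_space A D
  using sizes islands by (rule Metric_space_archipelago)

lemma card_island: "card (island i) = card (X i)"
  unfolding island_def by (rule card_image) (simp add: inj_on_def)

lemma card_mem: "card (X i) \<in> L"
  using islands by (simp add: islands_def)

lemma two_le_card: "2 \<le> card (X i)"
  using card_mem[of i] sizes by (metis Suc_1 Suc_leI One_nat_def)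

lemma island_subset: "island i \<subseteq> A"
  by (auto simp: island_def archipelago_set_def wedge_set_def cone_set_def)

lemma base_mem: "None \<in> A"
  by (simp add: archipelago_set_def wedge_set_def)

lemma dist_equidistant: "\<lbrakk>x \<in> X i; y \<in> X i; x \<noteq> y\<rbrakk> \<Longrightarrow> d i x y = diam (X i) (d i)"
  and one_le_diam: "1 \<le> diam (X i) (d i)"
proof -
  have ms: "Metric_space (X i) (d i)"
    using islands by (simp add: islands_def)
  obtain m :: nat where m: "card (X i) \<le> m"
    "\<And>x y. x \<in> X i \<Longrightarrow> y \<in> X i \<Longrightarrow> x \<noteq> y \<Longrightarrow> d i x y = real m"
    using islands unfolding islands_def by metis
  have diam: "diam (X i) (d i) = real m"
    using two_le_card[of i] by (intro diam_equidistant[OF ms _ m(2)]) auto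
  show "d i x y = diam (X i) (d i)" if "x \<in> X i" "y \<in> X i" "x \<noteq> y"
    using m(2) that diam by simp
  show "1 \<le> diam (X i) (d i)"
    using m(1) two_le_card[of i] diam by simp
qed

lemma dist_island:
  assumes "z \<in> island i" "z' \<in> island i" "z \<noteq> z'"
  shows "D z z' = diam (X i) (d i)"
  using assms by (auto simp: island_def archipelago_dist_def intro: dist_equidistant)

lemma dist_base_island: "z \<in> island i \<Longrightarrow> D None z = cone_height X d i"
  by (auto simp: island_def archipelago_dist_def)

lemma less_cone_height: "real i < cone_height X d i"
proof -
  have "(\<Sum>j\<le>i. 1) \<le> cone_height X d i"
    unfolding cone_height_def by (intro sum_mono one_le_diam)
  then show ?thesis by simp
qed

text \<open>Between different islands the wedge distance is the larger of the two cone heights,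
  hence at least the height of \<open>z\<close>.\<close>

lemma same_island_if_close:
  assumes "z \<in> island i" "z' \<in> A" "D z z' < D None z"
  shows "z' \<in> island i"
  using assms
  by (auto simp: island_def archipelago_dist_def archipelago_set_def wedge_set_def cone_set_def
      split: if_splits)

lemma far_imp_island:
  assumes "z \<in> A" "0 < D None z"
  obtains i where "z \<in> island i"
  using assms
  by (auto simp: island_def archipelago_dist_def archipelago_set_def wedge_set_def cone_set_def)

text \<open>An infinite set of indices is unbounded, and the cone height exceeds the index because
  every diameter is at least 1.\<close>

lemma exists_far_island:
  assumes "n \<in> L" "n \<le> m"
  obtains i where "card (X i) = n" "diam (X i) (d i) = real m" "r < cone_height X d i"
proof -
  have "infinite {i. diam (X i) (d i) = real m \<and> card (X i) = n}"
    using islands assms by (simp add: islands_def)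
  then obtain i where "nat \<lceil>r\<rceil> \<le> i" "diam (X i) (d i) = real m" "card (X i) = n"
    unfolding infinite_nat_iff_unbounded_le by blast
  moreover from this have "r < cone_height X d i"
    using less_cone_height[of i] by linarith
  ultimately show thesis using that by blast
qed

end

lemma (in Metric_space) metrically_proper_far:
  assumes "Metric_space N e" "metrically_proper M d N e f" "a \<in> M" "b \<in> N" "f \<in> M \<rightarrow> N"
  obtains s where "\<And>x. x \<in> M \<Longrightarrow> s < d a x \<Longrightarrow> r < e b (f x)"
proof -
  interpret N: Metric_space N e by fact
  have "mbounded {x \<in> M. f x \<in> N.mcball b r}"
    using assms(2) N.mbounded_mcball unfolding metrically_proper_def by blast
  then obtain c B where cB: "{x \<in> M. f x \<in> N.mcball b r} \<subseteq> mcball c B"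
    unfolding mbounded_def by blast
  \<comment> \<open>The bounded preimage lies in a ball around some \<open>c\<close>; by the
    triangle inequality, radius \<open>d a c + B\<close> around \<open>a\<close> covers it.\<close>
  have "r < e b (f x)" if x: "x \<in> M" "d a c + B < d a x" for x
  proof (rule ccontr)
    assume "\<not> r < e b (f x)"
    with x assms have "f x \<in> N.mcball b r" by (auto simp: Pi_iff)
    with cB x have "x \<in> mcball c B" by blast
    then have "d c x \<le> B" "c \<in> M" by auto
    with triangle[of a c x] x assms(3) show False by auto
  qed
  then show thesis using that by blast
qed

lemma sizes_subset_if_coarsely_equivalent:
  assumes "archipelago L\<^sub>1 X dX" "archipelago L\<^sub>2 Y dY"
    and "coarsely_equivalent (archipelago_set X) (archipelago_dist X dX)
           (archipelago_set Y) (archipelago_dist Y dY)"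
  shows "L\<^sub>1 \<subseteq> L\<^sub>2"
proof
  fix n assume n: "n \<in> L\<^sub>1"
  interpret X: archipelago L\<^sub>1 X dX by fact
  interpret Y: archipelago L\<^sub>2 Y dY by fact
  obtain C f g where f: "coarse_map X.A X.D Y.A Y.D f" and g: "coarse_map Y.A Y.D X.A X.D g"
    and gf: "\<And>x. x \<in> X.A \<Longrightarrow> X.D (g (f x)) x \<le> C" and fg: "\<And>y. y \<in> Y.A \<Longrightarrow> Y.D (f (g y)) y \<le> C"
    and "C > 0"
    using assms(3) unfolding coarsely_equivalent_def by blast
  have fA: "f \<in> X.A \<rightarrow> Y.A" and gA: "g \<in> Y.A \<rightarrow> X.A"
    and proper: "metrically_proper X.A X.D Y.A Y.D f"
    using f g by (auto simp: coarse_map_def)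
  obtain \<delta> where \<delta>0: "\<delta> \<in> {0..} \<rightarrow> {0..}"
    and \<delta>: "\<And>x x'. x \<in> X.A \<Longrightarrow> x' \<in> X.A \<Longrightarrow> Y.D (f x) (f x') \<le> \<delta> (X.D x x')"
    using f unfolding coarse_map_def large_scale_uniform_def by blast
  obtain \<epsilon> where \<epsilon>0: "\<epsilon> \<in> {0..} \<rightarrow> {0..}" and \<epsilon>_mono: "mono_on {0..} \<epsilon>"
    and \<epsilon>: "\<And>y y'. y \<in> Y.A \<Longrightarrow> y' \<in> Y.A \<Longrightarrow> X.D (g y) (g y') \<le> \<epsilon> (Y.D y y')"
    using g unfolding coarse_map_def large_scale_uniform_def by blast
  \<comment> \<open>\<open>n \<le> m\<close> makes such islands exist, \<open>C < m\<close> will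
    make \<open>g\<close> undo \<open>f\<close> exactly, and \<open>\<epsilon> C < m\<close> will
    keep the image island from having small diameter.\<close>
  define m where "m = max n (nat \<lceil>max C (\<epsilon> C)\<rceil> + 1)"
  have nm: "n \<le> m" and Cm: "C < real m" and \<epsilon>m: "\<epsilon> C < real m"
    unfolding m_def by linarith+
  obtain s where s: "\<And>x. x \<in> X.A \<Longrightarrow> s < X.D None x \<Longrightarrow> \<delta> (real m) < Y.D None (f x)"
    using X.metrically_proper_far[OF Y.Metric_space_axioms proper X.base_mem Y.base_mem fA]
    by blast
  \<comment> \<open>Height above \<open>s\<close> forces the image into one island; height above
    \<open>\<epsilon> (\<delta> m) + C\<close> prevents \<open>g\<close> from leaving the original
    island on the way back.\<close>
  obtain i where i: "card (X i) = n" "diam (X i) (dX i) = real m"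
      "max s (\<epsilon> (\<delta> (real m)) + C) < cone_height X dX i"
    using X.exists_far_island[OF n nm] .
  define I where "I = X.island i"
  have IA: "I \<subseteq> X.A" unfolding I_def by (rule X.island_subset)
  have I_far: "s < X.D None x" "\<epsilon> (\<delta> (real m)) + C < X.D None x" if "x \<in> I" for x
    using i(3) that X.dist_base_island[of x i] by (auto simp: I_def)
  have I_dist: "X.D x x' = real m" if "x \<in> I" "x' \<in> I" "x \<noteq> x'" for x x'
    using that X.dist_island[of x i x'] i(2) by (simp add: I_def)
  have \<delta>m0: "0 \<le> \<delta> (real m)" using \<delta>0 by auto
  have "2 \<le> card I" using X.two_le_card[of i] by (simp add: I_def X.card_island)
  then obtain a a' where aa': "a \<in> I" "a' \<in> I" "a \<noteq> a'"
    by (metis card_le_Suc0_iff_eq card.infinite not_less_eq_eq numeral_2_eq_2 zero_less_Suc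
        le_zero_eq nat.distinct(1))
  have faA: "f a \<in> Y.A" using aa' IA fA by blast
  obtain j where j: "f a \<in> Y.island j"
    using Y.far_imp_island[OF faA] s[of a] I_far[of a] IA aa' \<delta>m0 by (meson order_le_less_trans subsetD)
  define J where "J = Y.island j"
  have JA: "J \<subseteq> Y.A" unfolding J_def by (rule Y.island_subset)
  have fIJ: "f x \<in> J" if x: "x \<in> I" for x
  proof (cases "x = a")
    case False
    have "Y.D (f a) (f x) \<le> \<delta> (real m)"
      using \<delta>[of a x] I_dist[of a x] x aa' IA False by auto
    also have "\<dots> < Y.D None (f a)"
      using s[of a] I_far[of a] IA aa' by auto
    finally show ?thesis
      using Y.same_island_if_close[OF j] fA IA x unfolding J_def by blast
  qed (use j in \<open>simp add: J_def\<close>)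
  \<comment> \<open>A displacement of at most \<open>C\<close> is below the cone height, so
    \<open>g (f x)\<close> stays in \<open>I\<close>; there distinct points are \<open>m > C\<close>
    apart.\<close>
  have gf_id: "g (f x) = x" if x: "x \<in> I" for x
  proof -
    have xA: "x \<in> X.A" and gfA: "g (f x) \<in> X.A" using x IA fA gA by auto
    have "0 \<le> \<epsilon> (\<delta> (real m))" using \<epsilon>0 \<delta>m0 by auto
    then have "X.D x (g (f x)) < X.D None x"
      using gf[OF xA] I_far[OF x] X.commute[of x "g (f x)"] by linarith
    then have "g (f x) \<in> I"
      using X.same_island_if_close gfA x unfolding I_def by blast
    with I_dist[of "g (f x)" x] gf[OF xA] x Cm show ?thesis by fastforce
  qed
  have ne: "f a \<noteq> f a'" using gf_id aa' by metis
  define k where "k = diam (Y j) (dY j)"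
  have J_dist: "Y.D y y' = k" if "y \<in> J" "y' \<in> J" "y \<noteq> y'" for y y'
    using that Y.dist_island[of y j y'] by (simp add: J_def k_def)
  have k: "Y.D (f a) (f a') = k" using J_dist fIJ aa' ne by blast
  have km: "k \<le> \<delta> (real m)"
    using \<delta>[of a a'] I_dist[of a a'] aa' IA k by auto
  \<comment> \<open>Otherwise \<open>g\<close> would send \<open>f a\<close> and \<open>f a'\<close>
    to points at most \<open>\<epsilon> C < m\<close> apart, yet these are \<open>a\<close> and
    \<open>a'\<close>, at distance \<open>m\<close>.\<close>
  have Ck: "C < k"
  proof (rule ccontr)
    assume "\<not> C < k"
    then have "\<epsilon> k \<le> \<epsilon> C"
      using \<epsilon>_mono \<open>C > 0\<close> Y.nonneg[of "f a" "f a'"] k by (auto intro: mono_onD)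
    moreover have "real m \<le> \<epsilon> k"
      using \<epsilon>[of "f a" "f a'"] gf_id aa' I_dist[of a a'] k fIJ JA by auto
    ultimately show False using \<epsilon>m by linarith
  qed
  \<comment> \<open>Since \<open>k \<le> \<delta> m\<close>, the point \<open>g y\<close> is within
    \<open>\<epsilon> (\<delta> m)\<close> of \<open>g (f a) = a\<close>, less than the height of
    \<open>I\<close>.\<close>
  have gJI: "g y \<in> I" if y: "y \<in> J" for y
  proof (cases "y = f a")
    case False
    have yA: "y \<in> Y.A" and gyA: "g y \<in> X.A" using y JA gA by auto
    have "X.D (g (f a)) (g y) \<le> \<epsilon> k"
      using \<epsilon>[of "f a" y] J_dist[of "f a" y] fIJ[of a] aa' y yA faA False by auto
    also have "\<dots> \<le> \<epsilon> (\<delta> (real m))"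
      using \<epsilon>_mono km Ck \<open>C > 0\<close> \<delta>m0 by (auto intro: mono_onD)
    also have "\<dots> < X.D None a" using I_far(2)[of a] aa' \<open>C > 0\<close> by linarith
    finally show ?thesis
      using X.same_island_if_close[of a i "g y"] gyA aa' gf_id[of a] unfolding I_def by simp
  qed (use gf_id aa' in simp)
  \<comment> \<open>Both points lie in \<open>J\<close>, where distinct points are
    \<open>k > C\<close> apart.\<close>
  have fg_id: "f (g y) = y" if y: "y \<in> J" for y
    using J_dist[of "f (g y)" y] fIJ[OF gJI[OF y]] fg[of y] JA y Ck by fastforce
  have "bij_betw f I J"
    by (rule bij_betw_byWitness[where f' = g]) (use gf_id fg_id fIJ gJI in auto)
  then have "card I = card J" by (rule bij_betw_same_card)
  then show "n \<in> L\<^sub>2"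
    using i(1) Y.card_mem[of j] by (simp add: I_def J_def X.card_island Y.card_island)
qed

lemma coarsely_equivalent_sym:
  "coarsely_equivalent X dX Y dY \<Longrightarrow> coarsely_equivalent Y dY X dX"
  unfolding coarsely_equivalent_def by blast

theorem proposition6p3:
  fixes L\<^sub>1 L\<^sub>2 :: "nat set"
    and X :: "nat \<Rightarrow> 'a set" and dX :: "nat \<Rightarrow> 'a \<Rightarrow> 'a \<Rightarrow> real"
    and Y :: "nat \<Rightarrow> 'b set" and dY :: "nat \<Rightarrow> 'b \<Rightarrow> 'b \<Rightarrow> real"
  assumes "L\<^sub>1 \<noteq> {}" and "\<forall>n\<in>L\<^sub>1. n > 1"
    and "L\<^sub>2 \<noteq> {}" and "\<forall>n\<in>L\<^sub>2. n > 1"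
    and "islands L\<^sub>1 X dX" and "islands L\<^sub>2 Y dY"
    and "L\<^sub>1 \<noteq> L\<^sub>2"
  shows "\<not> coarsely_equivalent (archipelago_set X) (archipelago_dist X dX)
             (archipelago_set Y) (archipelago_dist Y dY)"
proof
  assume eq: "coarsely_equivalent (archipelago_set X) (archipelago_dist X dX)
             (archipelago_set Y) (archipelago_dist Y dY)"
  have "archipelago L\<^sub>1 X dX" "archipelago L\<^sub>2 Y dY"
    using assms by (simp_all add: archipelago_def)
  with eq have "L\<^sub>1 \<subseteq> L\<^sub>2" "L\<^sub>2 \<subseteq> L\<^sub>1"
    by (auto dest: sizes_subset_if_coarsely_equivalent coarsely_equivalent_sym)
  with assms(7) show False by simp
qed

end
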